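(* Let $G$ and $G'$ be 2-equivalent graphs with transition matrices $U=U(G)$ and $\overline{U}=U(G')$. Then $$\mathrm{spec}(S^+(U^3))=\mathrm{spec}(S^+(\overline{U}^3)).$$
   Context: Graphs are finite, simple and undirected. Transition matrix: for a graph $G$, replace each edge $\{u,v\}$ by the two directed arcs $uv$ and $vu$. The matrix $U=U(G)$ is indexed (rows and columns) by these arcs, with $$U_{wx,uv}=\begin{cases}\frac{2}{\deg(v)} & v=w,\ u\neq x\\ \frac{2}{\deg(v)}-1 & v=w,\ u=x\\ 0 & \text{otherwise.}\end{cases}$$ The positive support $S^+(M)$ of a real matrix $M$ is the $0$-$1$ matrix with $S^+(M)_{ab}=1$ if $M_{ab}>0$ and $0$ otherwise. $\mathrm{spec}$ denotes the spectrum (eigenvalues with multiplicities). Cellular algebras: for a finite set $V$, $\mathrm{Mat}_V$ is the algebra of complex matrices indexed by $V$. A cellular algebra on $V$ is a subalgebra $W\subseteq\mathrm{Mat}_V$ closed under Hadamard (entrywise) multiplication $\circ$ and under conjugate transpose $^\dagger$, and containing the identity $I$ and the all-ones matrix $J$. The smallest cellular algebra containing given matrices or sets of matrices is denoted $[\,\cdot\,]$. For a graph $G$ with adjacency matrix $A$, $[G]=[A]$. A weak isomorphism $W\to W'$ between cellular algebras is a linear bijection that preserves matrix multiplication, Hadamard multiplication and conjugate transpose. Extensions: for a group $\Gamma$ acting on a finite set $S$, $\mathcal{Z}(\Gamma,S)=\{A\in\mathrm{Mat}_S: A^g=A\ \forall g\in\Gamma\}$, where $A^g$ is $A$ with rows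 and columns permuted by $g$. $\mathrm{Sym}(V)$ acts entrywise on $V^k$. The $k$-extension of $W$ is $\widehat{W}^{(k)}=[W^k,\mathcal{Z}(\mathrm{Sym}(V),V^k)]\subseteq\mathrm{Mat}_{V^k}$, where $W^k$ is the $k$-fold tensor power of $W$. Equivalence: let $G,G'$ have adjacency matrices $A,A'$. An equivalence from $G$ to $G'$ is a weak isomorphism $\phi:[G]\to[G']$ with $\phi(A)=A'$. It is a $k$-equivalence if moreover there is a weak isomorphism $\widehat\phi:\widehat{[G]}^{(k)}\to\widehat{[G']}^{(k)}$ with $\widehat\phi|_{[G]^k}=\phi^k$ (the $k$-fold tensor power of $\phi$) and $\widehat\phi|_{\mathcal{Z}(\mathrm{Sym}(V),V^k)}$ the identity; here the vertex sets of $G$ and $G'$ have equal size and are identified with a common set $V$ by a bijection (the choice is immaterial). $G$ and $G'$ are $k$-equivalent if a $k$-equivalence from $G$ to $G'$ exists. *)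

theory Defs
  imports
    "Graph_Theory.Pair_Digraph"
    "Jordan_Normal_Form.Char_Poly"
begin

text \<open>
  Graphs are the library's \<open>pair_graph\<close>s (finite, loop-free, symmetric, at most one arc per
  ordered pair), so that \<open>parcs G\<close> already consists of the two arcs \<open>(u,v)\<close> and \<open>(v,u)\<close> of
  every edge \<open>{u,v}\<close>.

  A matrix indexed by a finite set \<open>S\<close> is a function of two arguments vanishing outside
  \<open>S \<times> S\<close>; this makes equality of functions coincide with equality of matrices over \<open>S\<close>.
\<close>

type_synonym ('i, 'c) imat = "'i \<Rightarrow> 'i \<Rightarrow> 'c"

definition Mat :: "'i set \<Rightarrow> ('i, 'c::zero) imat set" where
  "Mat S = {M. \<forall>a b. M a b \<noteq> 0 \<longrightarrow> a \<in> S \<and> b \<in> S}"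

definition imat_zero :: "('i, 'c::zero) imat" where
  "imat_zero = (\<lambda>a b. 0)"

definition imat_add :: "('i, 'c::plus) imat \<Rightarrow> ('i, 'c) imat \<Rightarrow> ('i, 'c) imat" where
  "imat_add A B = (\<lambda>a b. A a b + B a b)"

definition imat_scale :: "'c::times \<Rightarrow> ('i, 'c) imat \<Rightarrow> ('i, 'c) imat" where
  "imat_scale c A = (\<lambda>a b. c * A a b)"

definition imat_mult ::
  "'i set \<Rightarrow> ('i, 'c::semiring_0) imat \<Rightarrow> ('i, 'c) imat \<Rightarrow> ('i, 'c) imat" where
  "imat_mult S A B = (\<lambda>a b. \<Sum>c\<in>S. A a c * B c b)"

definition imat_id :: "'i set \<Rightarrow> ('i, 'c::zero_neq_one) imat" where
  "imat_id S = (\<lambda>a b. if a \<in> S \<and> b \<in> S \<and> a = b then 1 else 0)"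

definition imat_all_ones :: "'i set \<Rightarrow> ('i, 'c::zero_neq_one) imat" where
  "imat_all_ones S = (\<lambda>a b. if a \<in> S \<and> b \<in> S then 1 else 0)"

definition hadamard :: "('i, 'c::times) imat \<Rightarrow> ('i, 'c) imat \<Rightarrow> ('i, 'c) imat" where
  "hadamard A B = (\<lambda>a b. A a b * B a b)"

definition dagger :: "('i, complex) imat \<Rightarrow> ('i, complex) imat" where
  "dagger A = (\<lambda>a b. cnj (A b a))"

primrec imat_power :: "'i set \<Rightarrow> ('i, 'c::semiring_1) imat \<Rightarrow> nat \<Rightarrow> ('i, 'c) imat" where
  "imat_power S A 0 = imat_id S"
| "imat_power S A (Suc n) = imat_mult S A (imat_power S A n)"


section \<open>Spectra\<close>

definition mat_of_imat :: "'i list \<Rightarrow> ('i, 'c) imat \<Rightarrow> 'c mat" where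
  "mat_of_imat xs M = mat (length xs) (length xs) (\<lambda>(i, j). M (xs ! i) (xs ! j))"

text \<open>
  The multiset of complex eigenvalues with algebraic multiplicity. The enumeration of the index
  set is irrelevant, see lemma \<open>imat_spec_eq\<close> below.
\<close>

definition imat_spec :: "'i set \<Rightarrow> ('i, complex) imat \<Rightarrow> complex multiset" where
  "imat_spec S M =
    proots (char_poly (mat_of_imat (SOME xs. distinct xs \<and> set xs = S) M))"

lemma similar_mat_of_imat:
  fixes M :: "('i, 'c::comm_ring_1) imat"
  assumes "distinct xs" "distinct ys" "set xs = set ys"
  shows "similar_mat (mat_of_imat xs M) (mat_of_imat ys M)"
proof -
  define n where "n = length xs"
  have ly: "length ys = n"
    using assms distinct_card[of xs] distinct_card[of ys] by (simp add: n_def)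
  define perm :: "'i list \<Rightarrow> 'i list \<Rightarrow> 'c mat" where
    "perm us vs = mat n n (\<lambda>(i, j). if us ! i = vs ! j then 1 else 0)" for us vs
  have sum_nth: "(\<Sum>j<n. f (vs ! j)) = sum f (set vs)"
    if "distinct vs" "length vs = n" for vs and f :: "'i \<Rightarrow> 'c"
    using that by (metis bij_betw_nth sum.reindex_bij_betw)
  have inverse: "perm us vs * perm vs us = 1\<^sub>m n"
    if "distinct us" "distinct vs" "set us = set vs" "length us = n" "length vs = n" for us vs
  proof (rule eq_matI)
    fix i j assume "i < dim_row (1\<^sub>m n :: 'c mat)" "j < dim_col (1\<^sub>m n :: 'c mat)"
    hence ij: "i < n" "j < n" by auto
    have "(perm us vs * perm vs us) $$ (i, j) =
        (\<Sum>k<n. (if us ! i = vs ! k then 1 else 0) * (if vs ! k = us ! j then 1 else 0))"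
      using ij by (simp add: perm_def scalar_prod_def atLeast0LessThan)
    also have "\<dots> = (\<Sum>v\<in>set vs. (if us ! i = v then 1 else 0) * (if v = us ! j then 1 else 0))"
      by (rule sum_nth) (use that in auto)
    also have "\<dots> = (\<Sum>v\<in>set vs. if us ! i = v then (if us ! i = us ! j then 1 else 0) else 0)"
      by (intro sum.cong) auto
    also have "\<dots> = (if us ! i = us ! j then 1 else 0)"
    proof -
      have "us ! i \<in> set vs"
        using ij that by (metis nth_mem)
      thus ?thesis by simp
    qed
    also have "\<dots> = 1\<^sub>m n $$ (i, j)"
      using ij that by (simp add: nth_eq_iff_index_eq)
    finally show "(perm us vs * perm vs us) $$ (i, j) = 1\<^sub>m n $$ (i, j)" .
  qed (auto simp: perm_def)
  have conj: "mat_of_imat xs M = perm xs ys * mat_of_imat ys M * perm ys xs"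
  proof (rule eq_matI)
    let ?R = "perm xs ys * mat_of_imat ys M * perm ys xs"
    fix i j assume "i < dim_row ?R" "j < dim_col ?R"
    hence ij: "i < n" "j < n" by (auto simp: perm_def)
    have xi: "xs ! i \<in> set ys" and xj: "xs ! j \<in> set ys"
      using ij assms unfolding n_def by (metis nth_mem)+
    have inner: "(perm xs ys * mat_of_imat ys M) $$ (i, l) = M (xs ! i) (ys ! l)" if "l < n" for l
    proof -
      have "(perm xs ys * mat_of_imat ys M) $$ (i, l) =
          (\<Sum>k<n. (if xs ! i = ys ! k then 1 else 0) * M (ys ! k) (ys ! l))"
        using ij that ly by (simp add: perm_def mat_of_imat_def scalar_prod_def atLeast0LessThan)
      also have "\<dots> = (\<Sum>v\<in>set ys. (if xs ! i = v then 1 else 0) * M v (ys ! l))"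
        by (rule sum_nth) (use assms ly in auto)
      also have "\<dots> = (\<Sum>v\<in>set ys. if xs ! i = v then M (xs ! i) (ys ! l) else 0)"
        by (intro sum.cong) auto
      also have "\<dots> = M (xs ! i) (ys ! l)"
        using xi by simp
      finally show ?thesis .
    qed
    have dims: "dim_row (perm xs ys * mat_of_imat ys M) = n"
      "dim_col (perm xs ys * mat_of_imat ys M) = n"
      using ly by (auto simp: perm_def mat_of_imat_def)
    have "?R $$ (i, j) =
        (\<Sum>l<n. (perm xs ys * mat_of_imat ys M) $$ (i, l) * perm ys xs $$ (l, j))"
      using ij dims
      by (subst index_mult_mat(1)) (auto simp: scalar_prod_def atLeast0LessThan perm_def
          simp del: index_mult_mat(1))
    also have "\<dots> = (\<Sum>l<n. M (xs ! i) (ys ! l) * (if ys ! l = xs ! j then 1 else 0))"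
    proof (intro sum.cong refl)
      fix l assume "l \<in> {..<n}"
      hence l: "l < n" by simp
      have "perm ys xs $$ (l, j) = (if ys ! l = xs ! j then 1 else 0)"
        using ij l by (simp add: perm_def)
      thus "(perm xs ys * mat_of_imat ys M) $$ (i, l) * perm ys xs $$ (l, j) =
          M (xs ! i) (ys ! l) * (if ys ! l = xs ! j then 1 else 0)"
        by (simp only: inner[OF l])
    qed
    also have "\<dots> = (\<Sum>v\<in>set ys. M (xs ! i) v * (if v = xs ! j then 1 else 0))"
      by (rule sum_nth) (use assms ly in auto)
    also have "\<dots> = (\<Sum>v\<in>set ys. if xs ! j = v then M (xs ! i) (xs ! j) else 0)"
      by (intro sum.cong) auto
    also have "\<dots> = M (xs ! i) (xs ! j)"
      using xj by simp
    finally show "mat_of_imat xs M $$ (i, j) = ?R $$ (i, j)"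
      using ij by (simp add: mat_of_imat_def n_def)
  qed (auto simp: perm_def mat_of_imat_def n_def)
  show ?thesis
  proof (rule similar_matI[OF _ _ _ conj])
    show "{mat_of_imat xs M, mat_of_imat ys M, perm xs ys, perm ys xs} \<subseteq> carrier_mat n n"
      using ly by (auto simp: mat_of_imat_def perm_def n_def)
    show "perm xs ys * perm ys xs = 1\<^sub>m n" "perm ys xs * perm xs ys = 1\<^sub>m n"
      by (rule inverse; use assms ly n_def in auto)+
  qed
qed

lemma imat_spec_eq:
  assumes "distinct xs" "set xs = S"
  shows "imat_spec S M = proots (char_poly (mat_of_imat xs M))"
proof -
  let ?ys = "SOME xs. distinct xs \<and> set xs = S"
  have ys: "distinct ?ys \<and> set ?ys = S"
    by (rule someI[of "\<lambda>xs. distinct xs \<and> set xs = S" xs]) (use assms in auto)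
  have "similar_mat (mat_of_imat ?ys M) (mat_of_imat xs M)"
    by (rule similar_mat_of_imat) (use ys assms in auto)
  thus ?thesis
    unfolding imat_spec_def by (simp add: char_poly_similar)
qed


section \<open>Transition matrix and positive support\<close>

definition adj_matrix :: "'a pair_pre_digraph \<Rightarrow> ('a, complex) imat" where
  "adj_matrix G = (\<lambda>u v. if (u, v) \<in> parcs G then 1 else 0)"

text \<open>In a \<open>pair_graph\<close> the out-degree of a vertex is its degree in the undirected graph.\<close>

definition deg :: "'a pair_pre_digraph \<Rightarrow> 'a \<Rightarrow> nat" where
  "deg G v = out_degree (with_proj G) v"

definition transition_matrix :: "'a pair_pre_digraph \<Rightarrow> ('a \<times> 'a, real) imat" where
  "transition_matrix G = (\<lambda>(w, x) (u, v).
    if (w, x) \<in> parcs G \<and> (u, v) \<in> parcs G then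
      (if v = w \<and> u \<noteq> x then 2 / real (deg G v)
       else if v = w \<and> u = x then 2 / real (deg G v) - 1
       else 0)
    else 0)"

definition pos_support :: "('i, real) imat \<Rightarrow> ('i, complex) imat" where
  "pos_support M = (\<lambda>a b. if M a b > 0 then 1 else 0)"


section \<open>Cellular algebras\<close>

definition linear_subspace :: "('i, complex) imat set \<Rightarrow> bool" where
  "linear_subspace X \<longleftrightarrow>
    imat_zero \<in> X \<and>
    (\<forall>A\<in>X. \<forall>B\<in>X. imat_add A B \<in> X) \<and>
    (\<forall>c. \<forall>A\<in>X. imat_scale c A \<in> X)"

definition cellular_algebra :: "'i set \<Rightarrow> ('i, complex) imat set \<Rightarrow> bool" where
  "cellular_algebra S W \<longleftrightarrow>
    W \<subseteq> Mat S \<and>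
    linear_subspace W \<and>
    (\<forall>A\<in>W. \<forall>B\<in>W. imat_mult S A B \<in> W) \<and>
    (\<forall>A\<in>W. \<forall>B\<in>W. hadamard A B \<in> W) \<and>
    (\<forall>A\<in>W. dagger A \<in> W) \<and>
    imat_id S \<in> W \<and>
    imat_all_ones S \<in> W"

text \<open>
  The cellular algebra generated by \<open>X\<close>: \<open>hull\<close> is the intersection of all cellular
  algebras on \<open>S\<close> containing \<open>X\<close>. It is meant for \<open>X \<subseteq> Mat S\<close>.
\<close>

definition cellular_closure ::
  "'i set \<Rightarrow> ('i, complex) imat set \<Rightarrow> ('i, complex) imat set" where
  "cellular_closure S X = cellular_algebra S hull X"

definition graph_algebra :: "'a pair_pre_digraph \<Rightarrow> ('a, complex) imat set" where
  "graph_algebra G = cellular_closure (pverts G) {adj_matrix G}"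

definition linear_map_on ::
  "('i, complex) imat set \<Rightarrow> (('i, complex) imat \<Rightarrow> ('j, complex) imat) \<Rightarrow> bool" where
  "linear_map_on X f \<longleftrightarrow>
    (\<forall>A\<in>X. \<forall>B\<in>X. f (imat_add A B) = imat_add (f A) (f B)) \<and>
    (\<forall>c. \<forall>A\<in>X. f (imat_scale c A) = imat_scale c (f A))"

text \<open>Here \<open>W\<close> and \<open>W'\<close> are cellular algebras on \<open>S\<close> and \<open>S'\<close>.\<close>

definition weak_isomorphism ::
  "'i set \<Rightarrow> ('i, complex) imat set \<Rightarrow> 'j set \<Rightarrow> ('j, complex) imat set \<Rightarrow>
    (('i, complex) imat \<Rightarrow> ('j, complex) imat) \<Rightarrow> bool" where
  "weak_isomorphism S W S' W' f \<longleftrightarrow>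
    bij_betw f W W' \<and>
    linear_map_on W f \<and>
    (\<forall>A\<in>W. \<forall>B\<in>W. f (imat_mult S A B) = imat_mult S' (f A) (f B)) \<and>
    (\<forall>A\<in>W. \<forall>B\<in>W. f (hadamard A B) = hadamard (f A) (f B)) \<and>
    (\<forall>A\<in>W. f (dagger A) = dagger (f A))"


section \<open>Extensions\<close>

definition tuples :: "'a set \<Rightarrow> nat \<Rightarrow> 'a list set" where
  "tuples V k = {xs. set xs \<subseteq> V \<and> length xs = k}"

definition tensor :: "('a, complex) imat list \<Rightarrow> ('a list, complex) imat" where
  "tensor As = (\<lambda>xs ys.
    if length xs = length As \<and> length ys = length As
    then \<Prod>i<length As. (As ! i) (xs ! i) (ys ! i) else 0)"

definition tensor_power ::
  "('a, complex) imat set \<Rightarrow> nat \<Rightarrow> ('a list, complex) imat set" where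
  "tensor_power W k = linear_subspace hull {tensor As | As. set As \<subseteq> W \<and> length As = k}"

text \<open>
  \<open>F\<close> restricted to the tensor power of \<open>W\<close> is the \<open>k\<close>-fold tensor power of the linear map
  \<open>f\<close> on \<open>W\<close>, i.e. the linear map sending each \<open>A1 \<otimes> \<dots> \<otimes> Ak\<close> to \<open>f A1 \<otimes> \<dots> \<otimes> f Ak\<close>.
\<close>

definition restricts_to_tensor_power ::
  "('a, complex) imat set \<Rightarrow> nat \<Rightarrow> (('a, complex) imat \<Rightarrow> ('b, complex) imat) \<Rightarrow>
    (('a list, complex) imat \<Rightarrow> ('b list, complex) imat) \<Rightarrow> bool" where
  "restricts_to_tensor_power W k f F \<longleftrightarrow>
    linear_map_on (tensor_power W k) F \<and>
    (\<forall>As. set As \<subseteq> W \<and> length As = k \<longrightarrow> F (tensor As) = tensor (map f As))"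

text \<open>A group acting on \<open>S\<close> is given by the set \<open>\<Gamma>\<close> of maps by which its elements act.\<close>

definition invariant_matrices :: "('i \<Rightarrow> 'i) set \<Rightarrow> 'i set \<Rightarrow> ('i, complex) imat set" where
  "invariant_matrices \<Gamma> S = {A \<in> Mat S. \<forall>g\<in>\<Gamma>. \<forall>a\<in>S. \<forall>b\<in>S. A (g a) (g b) = A a b}"

definition sym_invariant :: "'a set \<Rightarrow> nat \<Rightarrow> ('a list, complex) imat set" where
  "sym_invariant V k = invariant_matrices {map g | g. g permutes V} (tuples V k)"

definition extension ::
  "'a set \<Rightarrow> ('a, complex) imat set \<Rightarrow> nat \<Rightarrow> ('a list, complex) imat set" where
  "extension V W k = cellular_closure (tuples V k) (tensor_power W k \<union> sym_invariant V k)"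


section \<open>Equivalence of graphs\<close>

definition graph_equivalence ::
  "'a pair_pre_digraph \<Rightarrow> 'b pair_pre_digraph \<Rightarrow>
    (('a, complex) imat \<Rightarrow> ('b, complex) imat) \<Rightarrow> bool" where
  "graph_equivalence G G' f \<longleftrightarrow>
    weak_isomorphism (pverts G) (graph_algebra G) (pverts G') (graph_algebra G') f \<and>
    f (adj_matrix G) = adj_matrix G'"

text \<open>
  \<open>F\<close> is the identity on the \<open>Sym(V)\<close>-invariant matrices when the two vertex sets are identified
  along the bijection \<open>\<sigma>\<close>. By \<open>Sym(V)\<close>-invariance the condition does not depend on \<open>\<sigma>\<close>.
\<close>

definition identity_on_sym_invariant ::
  "'a set \<Rightarrow> nat \<Rightarrow> ('a \<Rightarrow> 'b) \<Rightarrow> (('a list, complex) imat \<Rightarrow> ('b list, complex) imat) \<Rightarrow> bool" where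
  "identity_on_sym_invariant V k \<sigma> F \<longleftrightarrow>
    (\<forall>Z\<in>sym_invariant V k. \<forall>xs\<in>tuples V k. \<forall>ys\<in>tuples V k.
      F Z (map \<sigma> xs) (map \<sigma> ys) = Z xs ys)"

definition k_equivalence ::
  "nat \<Rightarrow> 'a pair_pre_digraph \<Rightarrow> 'b pair_pre_digraph \<Rightarrow>
    (('a, complex) imat \<Rightarrow> ('b, complex) imat) \<Rightarrow> bool" where
  "k_equivalence k G G' f \<longleftrightarrow>
    graph_equivalence G G' f \<and>
    (\<exists>\<sigma> F. bij_betw \<sigma> (pverts G) (pverts G') \<and>
      weak_isomorphism
        (tuples (pverts G) k) (extension (pverts G) (graph_algebra G) k)
        (tuples (pverts G') k) (extension (pverts G') (graph_algebra G') k) F \<and>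
      restricts_to_tensor_power (graph_algebra G) k f F \<and>
      identity_on_sym_invariant (pverts G) k \<sigma> F)"

definition k_equivalent :: "nat \<Rightarrow> 'a pair_pre_digraph \<Rightarrow> 'b pair_pre_digraph \<Rightarrow> bool" where
  "k_equivalent k G G' \<longleftrightarrow> (\<exists>f. k_equivalence k G G' f)"

end

theory Submission
  imports Defs "Jordan_Normal_Form.Schur_Decomposition"
begin

text \<open>
  A weak isomorphism commutes with matrix multiplication and with the entrywise product. The
  second property is much stronger than it looks: a matrix has finitely many entries, so any
  function \<open>\<complex> \<rightarrow> \<complex>\<close> agrees on them with a polynomial, and hence a weak isomorphism commutes
  with applying an arbitrary function to all entries (lemma \<open>corr_entrywise\<close>). Two functions
  matter here. On the vertices, \<open>z \<mapsto> 2 / z\<close> turns the matrix \<open>A J\<close> of degrees into the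
  coefficients of the transition matrix \<open>U\<close>; on pairs of vertices, the indicator function of
  \<open>Re z > 0\<close> turns \<open>U\<^sup>3\<close> into its positive support.

  A matrix indexed by arcs, extended by zero, is a matrix indexed by pairs of vertices. In this
  form \<open>U\<close> belongs to the 2-extension of \<open>[G]\<close>: it is written with tensor products of matrices
  of \<open>[G]\<close> and with \<open>Sym(V)\<close>-invariant matrices that compare the end of one pair with the start
  of another (lemma \<open>transition_matrix_formula\<close>). The same formula holds for \<open>G'\<close>, and the weak
  isomorphism \<open>F\<close> of the 2-extensions is prescribed on all its ingredients. So \<open>F\<close> maps \<open>U(G)\<close>
  to \<open>U(G')\<close>, and therefore the positive support of any power of \<open>U(G)\<close> to that of the same
  power of \<open>U(G')\<close>.

  Finally \<open>F\<close> preserves traces, since \<open>J X J\<close> is the sum of the entries of \<open>X\<close> times \<open>J\<close>, and the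
  trace of \<open>M\<close> is the sum of the entries of the entrywise product of \<open>I\<close> and \<open>M\<close>. The traces of
  all powers of a matrix are the power sums of its eigenvalues, and these determine the multiset
  of eigenvalues in characteristic zero.
\<close>

section \<open>Interpolation and power sums\<close>

lemma interpolating_poly:
  fixes h :: "'c::field \<Rightarrow> 'c"
  assumes "finite X"
  obtains p where "\<And>x. x \<in> X \<Longrightarrow> poly p x = h x"
proof -
  have "\<exists>p. \<forall>x\<in>X. poly p x = h x"
    using assms
  proof induction
    case (insert a X)
    then obtain p where p: "\<And>x. x \<in> X \<Longrightarrow> poly p x = h x" by blast
    define z where "z = (\<Prod>x\<in>X. [:- x, 1:])"
    have "poly z x = 0" if "x \<in> X" for x
      using that insert.hyps(1) by (auto simp: z_def poly_prod)
    moreover have "poly z a \<noteq> 0"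
      using insert.hyps by (auto simp: z_def poly_prod)
    ultimately have "\<forall>x\<in>insert a X. poly (p + Polynomial.smult ((h a - poly p a) / poly z a) z) x = h x"
      using p by simp
    thus ?case by blast
  qed simp
  thus ?thesis using that by blast
qed

lemma sum_mset_poly:
  fixes P :: "'c::comm_semiring_1 multiset"
  shows "(\<Sum>x\<in>#P. poly p x) = (\<Sum>k\<le>degree p. coeff p k * (\<Sum>x\<in>#P. x ^ k))"
  by (induction P) (simp_all add: poly_altdef ring_distribs sum.distrib)

text \<open>
  Equality of all power sums, the zeroth included, means that \<open>P\<close> and \<open>Q\<close> give the same sum for
  every polynomial. Taking a polynomial that is 1 at \<open>a\<close> and 0 at all other elements of \<open>P\<close> and
  \<open>Q\<close> compares the multiplicities of \<open>a\<close>; characteristic zero makes them equal as natural numbers.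
\<close>
lemma multiset_eq_if_power_sums_eq:
  fixes P Q :: "'c::field_char_0 multiset"
  assumes "\<And>k. (\<Sum>x\<in>#P. x ^ k) = (\<Sum>x\<in>#Q. x ^ k)"
  shows "P = Q"
proof (rule multiset_eqI)
  fix a
  obtain p where p: "\<And>x. x \<in> insert a (set_mset P \<union> set_mset Q) \<Longrightarrow>
      poly p x = (if x = a then 1 else 0)"
    using interpolating_poly[of "insert a (set_mset P \<union> set_mset Q)" "\<lambda>x. if x = a then 1 else 0"]
    by auto
  have count: "(\<Sum>x\<in>#R. poly p x) = of_nat (count R a)" if "set_mset R \<subseteq> set_mset P \<union> set_mset Q" for R
  proof -
    have "(\<Sum>x\<in>#R. poly p x) = (\<Sum>x\<in>#R. if x = a then 1 else 0)"
      using that by (intro arg_cong[of _ _ sum_mset] image_mset_cong p) auto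
    also have "\<dots> = of_nat (count R a)"
      by (induction R) auto
    finally show ?thesis .
  qed
  have "(\<Sum>x\<in>#P. poly p x) = (\<Sum>x\<in>#Q. poly p x)"
    by (simp add: sum_mset_poly assms)
  thus "count P a = count Q a"
    by (simp add: count)
qed


section \<open>Traces and spectra\<close>

definition mat_trace :: "'c::comm_monoid_add mat \<Rightarrow> 'c" where
  "mat_trace A = (\<Sum>i<dim_row A. A $$ (i, i))"

lemma mat_trace_mult_commute:
  fixes A B :: "'c::comm_semiring_0 mat"
  assumes "A \<in> carrier_mat n m" "B \<in> carrier_mat m n"
  shows "mat_trace (A * B) = mat_trace (B * A)"
proof -
  have "mat_trace (A * B) = (\<Sum>i<n. \<Sum>j<m. A $$ (i, j) * B $$ (j, i))"
    using assms by (auto simp: mat_trace_def scalar_prod_def atLeast0LessThan)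
  also have "\<dots> = (\<Sum>j<m. \<Sum>i<n. B $$ (j, i) * A $$ (i, j))"
    by (subst sum.swap) (simp add: mult.commute)
  also have "\<dots> = mat_trace (B * A)"
    using assms by (auto simp: mat_trace_def scalar_prod_def atLeast0LessThan)
  finally show ?thesis .
qed

lemma mat_trace_similar:
  fixes A B :: "'c::comm_ring_1 mat"
  assumes "similar_mat_wit A B P Q"
  shows "mat_trace A = mat_trace B"
proof -
  define n where "n = dim_row A"
  note w = similar_mat_witD[OF n_def assms]
  have "mat_trace A = mat_trace (P * (B * Q))"
    using w by (simp add: assoc_mult_mat[of _ n n _ n _ n])
  also have "\<dots> = mat_trace (B * Q * P)"
    using w by (intro mat_trace_mult_commute[of _ n n]) auto
  also have "B * Q * P = B"
    using w by (simp add: assoc_mult_mat[of _ n n _ n _ n])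
  finally show ?thesis .
qed

lemma upper_triangular_pow:
  fixes B :: "'c::comm_semiring_1 mat"
  assumes B: "B \<in> carrier_mat n n" and ut: "upper_triangular B"
  shows "upper_triangular (B ^\<^sub>m k) \<and> (\<forall>i<n. (B ^\<^sub>m k) $$ (i, i) = (B $$ (i, i)) ^ k)"
proof (induction k)
  case 0
  thus ?case using B by (auto simp: upper_triangular_def)
next
  case (Suc k)
  have C: "B ^\<^sub>m k \<in> carrier_mat n n" using B by simp
  have entry: "(B ^\<^sub>m Suc k) $$ (i, j) = (\<Sum>l<n. (B ^\<^sub>m k) $$ (i, l) * B $$ (l, j))"
    if "i < n" "j < n" for i j
    using that B C by (simp add: scalar_prod_def atLeast0LessThan)
  have low: "(B ^\<^sub>m k) $$ (i, l) = 0" if "l < i" "i < n" for i l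
    using Suc that C by (auto simp: upper_triangular_def)
  have lowB: "B $$ (i, l) = 0" if "l < i" "i < n" for i l
    using ut that B by (auto simp: upper_triangular_def)
  have "(B ^\<^sub>m Suc k) $$ (i, j) = 0" if "j < i" "i < n" for i j
  proof -
    have "(B ^\<^sub>m k) $$ (i, l) * B $$ (l, j) = 0" if "l < n" for l
      using low[of l i] lowB[of j l] \<open>j < i\<close> \<open>i < n\<close> that by (cases "l < i") auto
    thus ?thesis using entry[of i j] that by simp
  qed
  moreover have "(B ^\<^sub>m Suc k) $$ (i, i) = (B $$ (i, i)) ^ Suc k" if "i < n" for i
  proof -
    have "(B ^\<^sub>m k) $$ (i, l) * B $$ (l, i) = (if l = i then (B $$ (i, i)) ^ Suc k else 0)"
      if "l < n" for l
      using low[of l i] lowB[of i l] Suc \<open>i < n\<close> that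
      by (cases l i rule: linorder_cases) (auto simp: mult.commute)
    hence "(B ^\<^sub>m Suc k) $$ (i, i) = (\<Sum>l<n. if l = i then (B $$ (i, i)) ^ Suc k else 0)"
      using entry[of i i] that by simp
    thus ?thesis using that by simp
  qed
  ultimately show ?case
    using B C by (auto simp: upper_triangular_def simp del: pow_mat.simps)
qed

text \<open>
  By Schur's theorem \<open>A\<close> is similar to an upper triangular matrix, whose diagonal lists the
  eigenvalues of \<open>A\<close>; the diagonal of its \<open>k\<close>-th power lists their \<open>k\<close>-th powers.
\<close>
lemma mat_trace_pow:
  fixes A :: "complex mat"
  assumes A: "A \<in> carrier_mat n n"
  shows "mat_trace (A ^\<^sub>m k) = (\<Sum>x\<in>#proots (char_poly A). x ^ k)"
proof -
  obtain es where es: "char_poly A = (\<Prod>a\<leftarrow>es. [:- a, 1:])"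
    using char_poly_factorized[OF A] by auto
  obtain B where B: "B \<in> carrier_mat n n" "upper_triangular B" "similar_mat A B"
    using schur_decomposition_exists[OF A es] by blast
  then obtain P Q where wit: "similar_mat_wit A B P Q"
    by (auto simp: similar_mat_def)
  have linear: "proots (\<Prod>a\<leftarrow>bs. [:- a, 1:]) = mset bs" for bs :: "complex list"
  proof (induction bs)
    case (Cons b bs)
    have "(\<Prod>a\<leftarrow>bs. [:- a, 1:]) \<noteq> 0"
      by (auto simp: prod_list_zero_iff)
    thus ?case using Cons by (simp add: proots_mult del: mult_pCons_left)
  qed simp
  have "mat_trace (A ^\<^sub>m k) = mat_trace (B ^\<^sub>m k)"
    by (rule mat_trace_similar[OF similar_mat_wit_pow[OF wit]])
  also have "\<dots> = (\<Sum>i<n. (B $$ (i, i)) ^ k)"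
    using upper_triangular_pow[OF B(1,2)] B(1) by (simp add: mat_trace_def)
  also have "\<dots> = (\<Sum>x\<in>#mset (diag_mat B). x ^ k)"
    using B(1) unfolding mset_map[symmetric] sum_mset_sum_list
    by (simp add: diag_mat_def o_def interv_sum_list_conv_sum_set_nat atLeast0LessThan)
  also have "mset (diag_mat B) = proots (char_poly A)"
    using linear char_poly_upper_triangular[OF B(1,2)] char_poly_similar[OF B(3)] by simp
  finally show ?thesis .
qed

definition imat_trace :: "'i set \<Rightarrow> ('i, 'c::comm_monoid_add) imat \<Rightarrow> 'c" where
  "imat_trace S M = (\<Sum>a\<in>S. M a a)"

lemma sum_nth:
  assumes "distinct xs"
  shows "(\<Sum>i<length xs. f (xs ! i)) = sum f (set xs)"
  using assms by (metis bij_betw_nth sum.reindex_bij_betw)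

lemma mat_of_imat_power:
  fixes M :: "('i, 'c::comm_semiring_1) imat"
  assumes "distinct xs"
  shows "mat_of_imat xs (imat_power (set xs) M k) = mat_of_imat xs M ^\<^sub>m k"
proof -
  define n where "n = length xs"
  let ?A = "mat_of_imat xs M"
  have A: "?A \<in> carrier_mat n n"
    by (simp add: mat_of_imat_def n_def)
  have mult: "mat_of_imat xs (imat_mult (set xs) M N) = ?A * mat_of_imat xs N" for N
    by (rule eq_matI)
      (auto simp: mat_of_imat_def imat_mult_def scalar_prod_def atLeast0LessThan
        sum_nth[OF assms, symmetric])
  have commute: "?A * ?A ^\<^sub>m k = ?A ^\<^sub>m k * ?A" for k
  proof (induction k)
    case (Suc k)
    have "?A * ?A ^\<^sub>m Suc k = (?A * ?A ^\<^sub>m k) * ?A"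
      using A by (simp add: assoc_mult_mat[of _ n n _ n _ n])
    thus ?case using Suc by simp
  qed (use A in simp)
  show ?thesis
  proof (induction k)
    case 0
    show ?case
      using assms by (intro eq_matI) (auto simp: mat_of_imat_def imat_id_def nth_eq_iff_index_eq)
  next
    case (Suc k)
    thus ?case by (simp add: mult commute)
  qed
qed

lemma imat_trace_power:
  assumes "finite S"
  shows "imat_trace S (imat_power S M k) = (\<Sum>x\<in>#imat_spec S M. x ^ k)"
proof -
  obtain xs where xs: "distinct xs" "set xs = S"
    using finite_distinct_list[OF assms] by blast
  have "imat_trace S N = mat_trace (mat_of_imat xs N)" for N :: "('a, complex) imat"
    using sum_nth[OF xs(1), of "\<lambda>a. N a a"] xs(2)
    by (simp add: imat_trace_def mat_trace_def mat_of_imat_def)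
  thus ?thesis
    using mat_of_imat_power[OF xs(1), of M k] xs(2)
      mat_trace_pow[of "mat_of_imat xs M" "length xs" k]
    by (simp add: imat_spec_eq[OF xs] mat_of_imat_def)
qed

text \<open>
  The index sets may be of different types; that they have the same size is the case \<open>k = 0\<close>.
\<close>
lemma imat_spec_eq_if_traces_eq:
  assumes "finite S" "finite S'"
    and "\<And>k. imat_trace S (imat_power S M k) = imat_trace S' (imat_power S' M' k)"
  shows "imat_spec S M = imat_spec S' M'"
  using assms by (intro multiset_eq_if_power_sums_eq) (simp flip: imat_trace_power)


section \<open>Weak isomorphisms of cellular algebras\<close>

lemma MatI: "(\<And>a b. M a b \<noteq> 0 \<Longrightarrow> a \<in> S \<and> b \<in> S) \<Longrightarrow> M \<in> Mat S"
  by (simp add: Mat_def)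

lemma Mat_outside: "M \<in> Mat S \<Longrightarrow> a \<notin> S \<or> b \<notin> S \<Longrightarrow> M a b = 0"
  by (auto simp: Mat_def)

lemma Mat_mult: "M \<in> Mat S \<Longrightarrow> N \<in> Mat S \<Longrightarrow> imat_mult T M N \<in> Mat S"
  unfolding Mat_def imat_mult_def by (smt (verit) mem_Collect_eq mult_not_zero sum.neutral)

lemma Mat_add:
  fixes M N :: "('i, 'c::monoid_add) imat"
  assumes "M \<in> Mat S" "N \<in> Mat S"
  shows "imat_add M N \<in> Mat S"
proof (rule MatI)
  fix a b
  assume "imat_add M N a b \<noteq> 0"
  hence "M a b \<noteq> 0 \<or> N a b \<noteq> 0" by (auto simp: imat_add_def)
  thus "a \<in> S \<and> b \<in> S" using assms by (auto simp: Mat_def)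
qed

lemma Mat_id: "imat_id S \<in> Mat S"
  by (auto simp: Mat_def imat_id_def)

lemma Mat_power: "M \<in> Mat S \<Longrightarrow> imat_power S M k \<in> Mat S"
  by (induction k) (auto simp: Mat_id Mat_mult)

lemma cellular_algebra_Mat: "cellular_algebra S (Mat S)"
  unfolding cellular_algebra_def linear_subspace_def
  by (auto simp: Mat_mult Mat_add Mat_id)
    (auto simp: Mat_def imat_zero_def imat_scale_def hadamard_def dagger_def
      imat_all_ones_def split: if_splits)

lemma cellular_algebra_closure:
  assumes "X \<subseteq> Mat S"
  shows "cellular_algebra S (cellular_closure S X)"
proof -
  have "cellular_closure S X \<subseteq> Mat S"
    unfolding cellular_closure_def using assms cellular_algebra_Mat
    by (rule hull_minimal[of X "Mat S" "cellular_algebra S"])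
  thus ?thesis
    unfolding cellular_closure_def hull_def cellular_algebra_def linear_subspace_def by blast
qed

definition entrywise :: "'i set \<Rightarrow> (complex \<Rightarrow> complex) \<Rightarrow> ('i, complex) imat \<Rightarrow> ('i, complex) imat" where
  "entrywise S h M = (\<lambda>a b. if a \<in> S \<and> b \<in> S then h (M a b) else 0)"

locale cellular_weak_isomorphism =
  fixes S :: "'i set" and W :: "('i, complex) imat set"
    and S' :: "'j set" and W' :: "('j, complex) imat set"
    and f :: "('i, complex) imat \<Rightarrow> ('j, complex) imat"
  assumes finite: "finite S" "finite S'"
    and cellular: "cellular_algebra S W" "cellular_algebra S' W'"
    and weak_iso: "weak_isomorphism S W S' W' f"
begin

text \<open>
  The weak isomorphism as a relation. Its rules follow the structure of a formula for a matrix, so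
  that one formula valid for both algebras is transferred by applying them repeatedly.
\<close>
definition corr :: "('i, complex) imat \<Rightarrow> ('j, complex) imat \<Rightarrow> bool" where
  "corr M M' \<longleftrightarrow> M \<in> W \<and> M' = f M"

lemma corr_Mat:
  assumes "corr M M'"
  shows "M \<in> Mat S" "M' \<in> Mat S'"
  using assms weak_iso cellular
  by (auto simp: corr_def weak_isomorphism_def cellular_algebra_def bij_betw_def)

lemma corr_surj: "M' \<in> W' \<Longrightarrow> \<exists>M. corr M M'"
  using weak_iso by (auto simp: corr_def weak_isomorphism_def bij_betw_def)

lemma corr_closed:
  assumes "corr M M'" "corr N N'"
  shows corr_add: "corr (imat_add M N) (imat_add M' N')"
    and corr_mult: "corr (imat_mult S M N) (imat_mult S' M' N')"
    and corr_hadamard: "corr (hadamard M N) (hadamard M' N')"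
  using assms weak_iso cellular(1)
  by (auto simp: corr_def weak_isomorphism_def linear_map_on_def cellular_algebra_def
      linear_subspace_def)

lemma corr_scale: "corr M M' \<Longrightarrow> corr (imat_scale c M) (imat_scale c M')"
  using weak_iso cellular(1)
  by (auto simp: corr_def weak_isomorphism_def linear_map_on_def cellular_algebra_def
      linear_subspace_def)

lemma corr_unique: "corr M M' \<Longrightarrow> corr M M'' \<Longrightarrow> M' = M''"
  by (simp add: corr_def)

text \<open>
  Preservation of \<open>I\<close> is not part of the definition of a weak isomorphism. It follows from
  surjectivity: the image of a left unit is a left unit on the image, so the product of
  the image of \<open>I\<close> with \<open>I\<close> equals both factors. The same argument gives \<open>J\<close>, the unit of
  the entrywise product.
\<close>
lemma corr_id: "corr (imat_id S) (imat_id S')"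
proof -
  have "imat_id S' \<in> W'"
    using cellular(2) by (simp add: cellular_algebra_def)
  then obtain X where X: "corr X (imat_id S')"
    using corr_surj by blast
  have I: "corr (imat_id S) (f (imat_id S))"
    using cellular(1) by (auto simp: corr_def cellular_algebra_def)
  have left: "imat_mult S (imat_id S) X = X"
  proof (intro ext)
    fix a b
    have "imat_mult S (imat_id S) X a b = (\<Sum>c\<in>S. if c = a then X a b else 0)"
      unfolding imat_mult_def imat_id_def by (intro sum.cong) (auto intro: Mat_outside)
    thus "imat_mult S (imat_id S) X a b = X a b"
      using finite(1) Mat_outside[OF corr_Mat(1)[OF X], of a b] by auto
  qed
  have right: "imat_mult S' M (imat_id S') = M" if M: "M \<in> Mat S'"
    for M :: "('j, complex) imat"
  proof (intro ext)
    fix a b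
    have "imat_mult S' M (imat_id S') a b = (\<Sum>c\<in>S'. if c = b then M a b else 0)"
      unfolding imat_mult_def imat_id_def by (intro sum.cong) auto
    thus "imat_mult S' M (imat_id S') a b = M a b"
      using finite(2) Mat_outside[OF M, of a b] by auto
  qed
  have "corr X (f (imat_id S))"
    using corr_mult[OF I X] left right[OF corr_Mat(2)[OF I]] by simp
  thus ?thesis using X I corr_unique by metis
qed

lemma corr_all_ones: "corr (imat_all_ones S) (imat_all_ones S')"
proof -
  have "imat_all_ones S' \<in> W'"
    using cellular(2) by (simp add: cellular_algebra_def)
  then obtain X where X: "corr X (imat_all_ones S')"
    using corr_surj by blast
  have J: "corr (imat_all_ones S) (f (imat_all_ones S))"
    using cellular(1) by (auto simp: corr_def cellular_algebra_def)
  have left: "hadamard (imat_all_ones S) X = X"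
    using Mat_outside[OF corr_Mat(1)[OF X]] by (auto simp: hadamard_def imat_all_ones_def fun_eq_iff)
  have right: "hadamard (f (imat_all_ones S)) (imat_all_ones S') = f (imat_all_ones S)"
    using Mat_outside[OF corr_Mat(2)[OF J]] by (auto simp: hadamard_def imat_all_ones_def fun_eq_iff)
  have "corr X (f (imat_all_ones S))"
    using corr_hadamard[OF J X] left right by simp
  thus ?thesis using X J corr_unique by metis
qed

text \<open>
  Horner's scheme: polynomials are built from constants, which enter as multiples of \<open>J\<close>, by
  addition and the entrywise product with \<open>M\<close>.
\<close>
lemma corr_entrywise_poly:
  assumes "corr M M'"
  shows "corr (entrywise S (poly p) M) (entrywise S' (poly p) M')"
proof (induction p)
  case 0
  have "entrywise T (poly 0) N = imat_scale 0 (imat_all_ones T)" for T and N :: "('k, complex) imat"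
    by (auto simp: entrywise_def imat_scale_def fun_eq_iff)
  thus ?case using corr_scale[OF corr_all_ones] by metis
next
  case (pCons c p)
  have eq: "entrywise T (poly (pCons c p)) N =
      imat_add (imat_scale c (imat_all_ones T)) (hadamard N (entrywise T (poly p) N))"
    for T and N :: "('k, complex) imat"
    by (auto simp: entrywise_def imat_scale_def imat_add_def hadamard_def imat_all_ones_def fun_eq_iff)
  show ?case
    unfolding eq
    by (intro corr_add corr_scale[OF corr_all_ones] corr_hadamard assms pCons.IH)
qed

text \<open>
  A single polynomial that agrees with \<open>h\<close> on the entries of both \<open>M\<close> and \<open>M'\<close> reduces this to
  the previous lemma. It is the step that handles division by degrees and positive supports.
\<close>
lemma corr_entrywise:
  assumes "corr M M'"
  shows "corr (entrywise S h M) (entrywise S' h M')"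
proof -
  define X where "X = case_prod M ` (S \<times> S) \<union> case_prod M' ` (S' \<times> S')"
  have "finite X" using finite by (simp add: X_def)
  then obtain p where p: "\<And>x. x \<in> X \<Longrightarrow> poly p x = h x"
    using interpolating_poly by blast
  have "entrywise S h M = entrywise S (poly p) M" "entrywise S' h M' = entrywise S' (poly p) M'"
    by (auto simp: entrywise_def fun_eq_iff X_def intro!: p[symmetric])
  thus ?thesis using corr_entrywise_poly[OF assms] by simp
qed

text \<open>
  The sum of the entries is an algebraic invariant because it is the factor in
  \<open>J M J = c J\<close>. For an empty \<open>S'\<close> this factor would not be determined.
\<close>
lemma corr_sum_entries:
  assumes "corr M M'" and "S' \<noteq> {}"
  shows "(\<Sum>a\<in>S. \<Sum>b\<in>S. M a b) = (\<Sum>a\<in>S'. \<Sum>b\<in>S'. M' a b)"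
proof -
  have JMJ: "imat_mult T (imat_mult T (imat_all_ones T) N) (imat_all_ones T) =
      imat_scale (\<Sum>a\<in>T. \<Sum>b\<in>T. N a b) (imat_all_ones T)" for T and N :: "('k, complex) imat"
  proof (intro ext)
    fix x y
    have "(\<Sum>b\<in>T. \<Sum>a\<in>T. N a b) = (\<Sum>a\<in>T. \<Sum>b\<in>T. N a b)"
      by (rule sum.swap)
    thus "imat_mult T (imat_mult T (imat_all_ones T) N) (imat_all_ones T) x y =
        imat_scale (\<Sum>a\<in>T. \<Sum>b\<in>T. N a b) (imat_all_ones T) x y"
      by (auto simp: imat_mult_def imat_scale_def imat_all_ones_def)
  qed
  have "corr (imat_mult S (imat_mult S (imat_all_ones S) M) (imat_all_ones S))
      (imat_mult S' (imat_mult S' (imat_all_ones S') M') (imat_all_ones S'))"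
    by (intro corr_mult corr_all_ones assms(1))
  hence "imat_scale (\<Sum>a\<in>S'. \<Sum>b\<in>S'. M' a b) (imat_all_ones S') =
      imat_scale (\<Sum>a\<in>S. \<Sum>b\<in>S. M a b) (imat_all_ones S')"
    unfolding JMJ using corr_scale[OF corr_all_ones] corr_unique by blast
  moreover obtain x where "x \<in> S'" using assms(2) by blast
  ultimately show ?thesis
    by (auto simp: imat_scale_def imat_all_ones_def dest!: fun_cong[of _ _ x])
qed

lemma corr_trace:
  assumes "corr M M'" and "S' \<noteq> {}"
  shows "imat_trace S M = imat_trace S' M'"
proof -
  have diag: "(\<Sum>a\<in>T. \<Sum>b\<in>T. hadamard (imat_id T) N a b) = imat_trace T N"
    if "finite T" for T and N :: "('k, complex) imat"
  proof -
    have "(\<Sum>b\<in>T. hadamard (imat_id T) N a b) = N a a" if "a \<in> T" for a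
    proof -
      have "(\<Sum>b\<in>T. hadamard (imat_id T) N a b) = (\<Sum>b\<in>T. if b = a then N a a else 0)"
        using that by (intro sum.cong) (auto simp: hadamard_def imat_id_def)
      thus ?thesis using \<open>finite T\<close> that by simp
    qed
    thus ?thesis by (simp add: imat_trace_def)
  qed
  show ?thesis
    using corr_sum_entries[OF corr_hadamard[OF corr_id assms(1)] assms(2)]
    by (simp add: diag finite)
qed

end


section \<open>Matrices on arcs as matrices on pairs of vertices\<close>

text \<open>
  The 2-extension is indexed by lists of length two, matrices on arcs by ordered pairs. A matrix on
  the arcs vanishes outside them, so reindexing also extends it by zero to all pairs of vertices.
\<close>
definition pair_lists :: "('a \<times> 'a, 'c::zero) imat \<Rightarrow> ('a list, 'c) imat" where
  "pair_lists M = (\<lambda>xs ys. if length xs = 2 \<and> length ys = 2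
    then M (xs ! 0, xs ! 1) (ys ! 0, ys ! 1) else 0)"

lemma pair_lists_simp [simp]: "pair_lists M [a, b] [c, d] = M (a, b) (c, d)"
  by (simp add: pair_lists_def)

lemma tuples_2: "tuples V 2 = (\<lambda>(a, b). [a, b]) ` (V \<times> V)"
  by (force simp: tuples_def numeral_2_eq_2 length_Suc_conv)

lemma finite_tuples_2: "finite V \<Longrightarrow> finite (tuples V 2)"
  by (simp add: tuples_2)

lemma in_tuples_2 [simp]: "[a, b] \<in> tuples V 2 \<longleftrightarrow> a \<in> V \<and> b \<in> V"
  by (auto simp: tuples_def)

lemma sum_tuples_2: "(\<Sum>xs\<in>tuples V 2. g xs) = (\<Sum>(a, b)\<in>V \<times> V. g [a, b])"
  unfolding tuples_2 by (subst sum.reindex) (auto simp: inj_on_def case_prod_beta intro!: sum.cong)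

lemma Mat_tuples_2_eqI:
  assumes "M \<in> Mat (tuples V 2)" "N \<in> Mat (tuples V 2)"
    and "\<And>a b c d. a \<in> V \<Longrightarrow> b \<in> V \<Longrightarrow> c \<in> V \<Longrightarrow> d \<in> V \<Longrightarrow> M [a, b] [c, d] = N [a, b] [c, d]"
  shows "M = N"
proof (intro ext)
  fix xs ys
  show "M xs ys = N xs ys"
  proof (cases "xs \<in> tuples V 2 \<and> ys \<in> tuples V 2")
    case True
    thus ?thesis using assms(3) by (auto simp: tuples_2)
  next
    case False
    thus ?thesis using assms(1,2) by (auto simp: Mat_outside)
  qed
qed

lemma pair_lists_Mat:
  assumes "M \<in> Mat R" "R \<subseteq> V \<times> V"
  shows "pair_lists M \<in> Mat (tuples V 2)"
proof (rule MatI)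
  have member: "xs \<in> tuples V 2" if "length xs = 2" "(xs ! 0, xs ! 1) \<in> R" for xs
    using that assms(2) by (auto simp: tuples_def numeral_2_eq_2 length_Suc_conv)
  fix xs ys
  assume "pair_lists M xs ys \<noteq> 0"
  hence "length xs = 2" "length ys = 2" "M (xs ! 0, xs ! 1) (ys ! 0, ys ! 1) \<noteq> 0"
    by (auto simp: pair_lists_def split: if_splits)
  thus "xs \<in> tuples V 2 \<and> ys \<in> tuples V 2"
    using assms(1) member by (auto simp: Mat_def)
qed

lemma pair_lists_mult:
  fixes M N :: "('a \<times> 'a, 'c::semiring_0) imat"
  assumes "finite V" "M \<in> Mat R" "N \<in> Mat R" "R \<subseteq> V \<times> V"
  shows "pair_lists (imat_mult R M N) = imat_mult (tuples V 2) (pair_lists M) (pair_lists N)"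
proof (rule Mat_tuples_2_eqI)
  show "pair_lists (imat_mult R M N) \<in> Mat (tuples V 2)"
    "imat_mult (tuples V 2) (pair_lists M) (pair_lists N) \<in> Mat (tuples V 2)"
    using assms by (auto intro: pair_lists_Mat Mat_mult)
  fix a b c d
  have "(\<Sum>x\<in>R. M (a, b) x * N x (c, d)) = (\<Sum>x\<in>V \<times> V. M (a, b) x * N x (c, d))"
    using assms by (intro sum.mono_neutral_left) (auto simp: Mat_outside)
  thus "pair_lists (imat_mult R M N) [a, b] [c, d] =
      imat_mult (tuples V 2) (pair_lists M) (pair_lists N) [a, b] [c, d]"
    by (simp add: imat_mult_def sum_tuples_2 case_prod_beta)
qed

lemma pair_lists_trace:
  assumes "finite V" "M \<in> Mat R" "R \<subseteq> V \<times> V"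
  shows "imat_trace (tuples V 2) (pair_lists M) = imat_trace R M"
proof -
  have "(\<Sum>x\<in>R. M x x) = (\<Sum>x\<in>V \<times> V. M x x)"
    using assms by (intro sum.mono_neutral_left) (auto simp: Mat_outside)
  thus ?thesis
    by (simp add: imat_trace_def sum_tuples_2 case_prod_beta)
qed

text \<open>
  The pairs \<open>(w, x)\<close> and \<open>(u, v)\<close> are compared crosswise, \<open>w = v\<close> and \<open>x = u\<close>: these are the
  conditions in the transition matrix. For \<open>\<phi>\<close> the conjunction, the result is the permutation
  matrix \<open>T\<close> that reverses pairs.
\<close>
definition pattern_matrix :: "'a set \<Rightarrow> (bool \<Rightarrow> bool \<Rightarrow> bool) \<Rightarrow> ('a list, complex) imat" where
  "pattern_matrix V \<phi> = (\<lambda>xs ys. if xs \<in> tuples V 2 \<and> ys \<in> tuples V 2 \<and>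
    \<phi> (xs ! 0 = ys ! 1) (xs ! 1 = ys ! 0) then 1 else 0)"

lemma pattern_matrix_Mat: "pattern_matrix V \<phi> \<in> Mat (tuples V 2)"
  by (auto simp: Mat_def pattern_matrix_def)

lemma pattern_matrix_map:
  assumes "bij_betw \<sigma> V V'" "xs \<in> tuples V 2" "ys \<in> tuples V 2"
  shows "pattern_matrix V' \<phi> (map \<sigma> xs) (map \<sigma> ys) = pattern_matrix V \<phi> xs ys"
proof -
  obtain a b c d where "xs = [a, b]" "ys = [c, d]" "a \<in> V" "b \<in> V" "c \<in> V" "d \<in> V"
    using assms(2,3) by (auto simp: tuples_2)
  thus ?thesis
    using assms(1) by (auto simp: pattern_matrix_def bij_betw_def inj_on_eq_iff)
qed

lemma pattern_matrix_sym_invariant: "pattern_matrix V \<phi> \<in> sym_invariant V 2"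
  unfolding sym_invariant_def invariant_matrices_def
  by (auto simp: pattern_matrix_Mat permutes_imp_bij intro!: pattern_matrix_map)

lemma tensor_2 [simp]: "tensor [X, Y] [a, b] [c, d] = X a c * Y b d"
  by (simp add: tensor_def lessThan_Suc)

lemma tensor_Mat:
  assumes "set As \<subseteq> Mat V"
  shows "tensor As \<in> Mat (tuples V (length As))"
proof (rule MatI)
  fix xs ys
  assume nz: "tensor As xs ys \<noteq> 0"
  hence len: "length xs = length As" "length ys = length As"
    by (auto simp: tensor_def split: if_splits)
  have "xs ! i \<in> V \<and> ys ! i \<in> V" if "i < length As" for i
  proof -
    have "(As ! i) (xs ! i) (ys ! i) \<noteq> 0"
      using nz len that by (auto simp: tensor_def)
    moreover have "As ! i \<in> Mat V" using assms that by auto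
    ultimately show ?thesis by (auto simp: Mat_def)
  qed
  thus "xs \<in> tuples V (length As) \<and> ys \<in> tuples V (length As)"
    using len by (auto simp: tuples_def set_conv_nth)
qed

text \<open>
  The adjacency of the two ends of one pair \<open>(a, b)\<close> is not visible in a tensor product, which
  relates entries of a row index to entries of a column index. Multiplying \<open>A \<otimes> J\<close> entrywise by
  the reversal \<open>T\<close> puts \<open>A a b\<close> at the position of row \<open>(a, b)\<close> and column \<open>(b, a)\<close>; a further
  multiplication by \<open>T\<close> moves it to the diagonal.
\<close>
lemma arc_identity_formula:
  assumes "finite (pverts G)" "parcs G \<subseteq> pverts G \<times> pverts G"
  defines "V \<equiv> pverts G"
  shows "pair_lists (imat_id (parcs G)) =
    imat_mult (tuples V 2)
      (hadamard (tensor [adj_matrix G, imat_all_ones V]) (pattern_matrix V (\<and>)))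
      (pattern_matrix V (\<and>))" (is "?L = ?R")
proof (rule Mat_tuples_2_eqI)
  show "?L \<in> Mat (tuples V 2)"
    using assms by (auto intro: pair_lists_Mat Mat_id)
  have "hadamard X (pattern_matrix V (\<and>)) \<in> Mat (tuples V 2)" for X
    by (auto simp: hadamard_def pattern_matrix_def Mat_def)
  thus "?R \<in> Mat (tuples V 2)"
    by (intro Mat_mult pattern_matrix_Mat)
  fix a b c d
  assume V: "a \<in> V" "b \<in> V" "c \<in> V" "d \<in> V"
  \<comment> \<open>only the reversed pair is related to \<open>(a, b)\<close> by the left factor\<close>
  have "?R [a, b] [c, d] = (\<Sum>x\<in>V \<times> V. if x = (b, a) then ?L [a, b] [c, d] else 0)"
    using V by (auto simp: imat_mult_def sum_tuples_2 hadamard_def pattern_matrix_def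
        imat_all_ones_def adj_matrix_def imat_id_def intro!: sum.cong)
  thus "?L [a, b] [c, d] = ?R [a, b] [c, d]"
    using V assms(1) by (simp add: V_def)
qed

lemma diagonal_mult_diagonal:
  fixes D N :: "('i, 'c::semiring_0) imat"
  assumes "finite S" "N \<in> Mat S" and diag: "\<And>a b. a \<noteq> b \<Longrightarrow> D a b = 0"
  shows "imat_mult S (imat_mult S D N) D = (\<lambda>a b. D a a * N a b * D b b)"
proof (intro ext)
  fix a b
  have left: "imat_mult S D N a b = D a a * N a b" for b
  proof -
    have "D a c * N c b = (if c = a then D a a * N a b else 0)" for c
      using diag[of a c] by (cases "c = a") auto
    hence "imat_mult S D N a b = (\<Sum>c\<in>S. if c = a then D a a * N a b else 0)"
      unfolding imat_mult_def by (intro sum.cong refl)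
    thus ?thesis using assms(1) Mat_outside[OF assms(2), of a b] by auto
  qed
  have "imat_mult S D N a c * D c b = (if c = b then D a a * N a b * D b b else 0)" for c
    using diag[of c b] by (cases "c = b") (auto simp: left)
  hence "imat_mult S (imat_mult S D N) D a b =
      (\<Sum>c\<in>S. if c = b then D a a * N a b * D b b else 0)"
    unfolding imat_mult_def[of S "imat_mult S D N"] by (intro sum.cong refl)
  thus "imat_mult S (imat_mult S D N) D a b = D a a * N a b * D b b"
    using assms(1) Mat_outside[OF assms(2), of a b] by auto
qed

lemma row_sum_adj_matrix:
  assumes "finite (pverts G)" "parcs G \<subseteq> pverts G \<times> pverts G" "v \<in> pverts G" "w \<in> pverts G"
  shows "imat_mult (pverts G) (adj_matrix G) (imat_all_ones (pverts G)) v w = of_nat (deg G v)"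
proof -
  have "out_arcs (with_proj G) v = Pair v ` {u \<in> pverts G. (v, u) \<in> parcs G}"
    using assms(2) by (auto simp: out_arcs_def)
  hence "deg G v = card {u \<in> pverts G. (v, u) \<in> parcs G}"
    by (simp add: deg_def out_degree_def card_image inj_on_def)
  thus ?thesis
    using assms by (simp add: imat_mult_def adj_matrix_def imat_all_ones_def sum.If_cases Int_def)
qed

definition complexify :: "('i, real) imat \<Rightarrow> ('i, complex) imat" where
  "complexify M = (\<lambda>a b. complex_of_real (M a b))"

lemma complexify_Mat: "M \<in> Mat S \<Longrightarrow> complexify M \<in> Mat S"
  by (simp add: Mat_def complexify_def)

lemma complexify_power: "complexify (imat_power S M k) = imat_power S (complexify M) k"
proof (induction k)
  case (Suc k)
  have "complexify (imat_mult S M N) = imat_mult S (complexify M) (complexify N)" for N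
    by (simp add: complexify_def imat_mult_def)
  thus ?case using Suc by simp
qed (simp add: complexify_def imat_id_def fun_eq_iff)

lemma transition_matrix_Mat: "transition_matrix G \<in> Mat (parcs G)"
  by (auto simp: Mat_def transition_matrix_def split: if_splits)

lemma pos_support_Mat:
  assumes "M \<in> Mat S"
  shows "pos_support M \<in> Mat S"
proof (rule MatI)
  fix a b
  assume "pos_support M a b \<noteq> 0"
  hence "M a b \<noteq> 0" by (auto simp: pos_support_def)
  thus "a \<in> S \<and> b \<in> S" using assms by (auto simp: Mat_def)
qed

lemma pos_support_entrywise:
  assumes "M \<in> Mat R" "R \<subseteq> V \<times> V"
  shows "pair_lists (pos_support M) =
    entrywise (tuples V 2) (\<lambda>z. if Re z > 0 then 1 else 0) (pair_lists (complexify M))"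
proof (rule Mat_tuples_2_eqI)
  show "pair_lists (pos_support M) \<in> Mat (tuples V 2)"
    using assms by (auto intro: pair_lists_Mat pos_support_Mat)
qed (auto simp: Mat_def entrywise_def pos_support_def complexify_def)

text \<open>
  For arcs \<open>(w, x)\<close> and \<open>(u, v)\<close> the entry of the transition matrix is \<open>2 / deg w\<close> if \<open>v = w\<close>, minus
  1 if the arcs are reverses of each other. All entries of row \<open>w\<close> of \<open>A J\<close> equal \<open>deg w\<close>, so
  the first part is \<open>E \<otimes> J\<close> restricted to the pattern \<open>v = w\<close>, where \<open>E\<close> arises from \<open>A J\<close>
  entrywise; the value \<open>2 / 0 = 0\<close> at isolated vertices is harmless, as they are on no arc.
  Multiplying by the diagonal matrix \<open>D\<close> on both sides removes all pairs of vertices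
  that are not arcs.
\<close>
lemma transition_matrix_formula:
  assumes "finite (pverts G)" "parcs G \<subseteq> pverts G \<times> pverts G"
  defines "V \<equiv> pverts G"
  defines "D \<equiv> pair_lists (imat_id (parcs G))"
    and "E \<equiv> entrywise V (\<lambda>z. 2 / z) (imat_mult V (adj_matrix G) (imat_all_ones V))"
  shows "pair_lists (complexify (transition_matrix G)) =
    imat_mult (tuples V 2) (imat_mult (tuples V 2) D
      (imat_add (hadamard (tensor [E, imat_all_ones V]) (pattern_matrix V (\<lambda>p q. p)))
        (imat_scale (-1) (pattern_matrix V (\<and>))))) D" (is "?L = imat_mult _ (imat_mult _ _ ?N) _")
proof -
  have N: "?N \<in> Mat (tuples V 2)"
    by (auto simp: Mat_def imat_add_def hadamard_def imat_scale_def pattern_matrix_def)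
  have "?L = (\<lambda>xs ys. D xs xs * ?N xs ys * D ys ys)"
  proof (rule Mat_tuples_2_eqI)
    show "?L \<in> Mat (tuples V 2)"
      using assms by (auto intro!: pair_lists_Mat complexify_Mat transition_matrix_Mat)
    show "(\<lambda>xs ys. D xs xs * ?N xs ys * D ys ys) \<in> Mat (tuples V 2)"
      using N by (auto simp: Mat_def)
    fix a b c d
    assume V: "a \<in> V" "b \<in> V" "c \<in> V" "d \<in> V"
    have "E a c = 2 / of_nat (deg G a)"
      using V assms(1,2) unfolding E_def V_def by (simp add: entrywise_def row_sum_adj_matrix)
    thus "?L [a, b] [c, d] = D [a, b] [a, b] * ?N [a, b] [c, d] * D [c, d] [c, d]"
      using V by (auto simp: D_def imat_id_def complexify_def transition_matrix_def imat_add_def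
          hadamard_def imat_scale_def pattern_matrix_def imat_all_ones_def)
  qed
  moreover have "D xs ys = 0" if "xs \<noteq> ys" for xs ys
    using that by (auto simp: D_def pair_lists_def imat_id_def numeral_2_eq_2 length_Suc_conv)
  ultimately show ?thesis
    using diagonal_mult_diagonal[OF finite_tuples_2 N, of D] assms(1) by (simp add: V_def)
qed


section \<open>Transition matrices of 2-equivalent graphs\<close>

lemma parcs_subset: "pair_graph G \<Longrightarrow> parcs G \<subseteq> pverts G \<times> pverts G"
  by (auto dest: pair_wf_digraph.in_arcsD1 pair_wf_digraph.in_arcsD2
      simp: pair_graph_def pair_digraph_def pair_fin_digraph_def)

lemma finite_pverts: "pair_graph G \<Longrightarrow> finite (pverts G)"
  by (simp add: pair_graph_def pair_digraph_def pair_fin_digraph_def pair_fin_digraph_axioms_def)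

lemma adj_matrix_Mat: "parcs G \<subseteq> pverts G \<times> pverts G \<Longrightarrow> adj_matrix G \<in> Mat (pverts G)"
  by (auto simp: Mat_def adj_matrix_def split: if_splits)

lemma cellular_graph_algebra:
  "parcs G \<subseteq> pverts G \<times> pverts G \<Longrightarrow> cellular_algebra (pverts G) (graph_algebra G)"
  unfolding graph_algebra_def by (rule cellular_algebra_closure) (simp add: adj_matrix_Mat)

lemma cellular_extension:
  assumes "cellular_algebra V W"
  shows "cellular_algebra (tuples V k) (extension V W k)"
proof -
  have "W \<subseteq> Mat V"
    using assms by (simp add: cellular_algebra_def)
  hence "{tensor As | As. set As \<subseteq> W \<and> length As = k} \<subseteq> Mat (tuples V k)"
    using tensor_Mat by blast
  moreover have "linear_subspace (Mat (tuples V k) :: ('a list, complex) imat set)"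
    using cellular_algebra_Mat[of "tuples V k"] by (simp add: cellular_algebra_def)
  ultimately have "tensor_power W k \<subseteq> Mat (tuples V k)"
    unfolding tensor_power_def by (rule hull_minimal[of _ "Mat (tuples V k)" linear_subspace])
  thus ?thesis
    unfolding extension_def
    by (intro cellular_algebra_closure) (auto simp: sym_invariant_def invariant_matrices_def)
qed

locale two_equivalence =
  fixes G :: "'a pair_pre_digraph" and G' :: "'b pair_pre_digraph"
    and f :: "('a, complex) imat \<Rightarrow> ('b, complex) imat"
    and \<sigma> :: "'a \<Rightarrow> 'b"
    and F :: "('a list, complex) imat \<Rightarrow> ('b list, complex) imat"
  assumes graphs: "pair_graph G" "pair_graph G'"
    and equivalence: "graph_equivalence G G' f"
    and bij: "bij_betw \<sigma> (pverts G) (pverts G')"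
    and extension_iso: "weak_isomorphism
        (tuples (pverts G) 2) (extension (pverts G) (graph_algebra G) 2)
        (tuples (pverts G') 2) (extension (pverts G') (graph_algebra G') 2) F"
    and on_tensors: "restricts_to_tensor_power (graph_algebra G) 2 f F"
    and on_invariants: "identity_on_sym_invariant (pverts G) 2 \<sigma> F"
begin

lemmas fin = graphs[THEN finite_pverts]
lemmas arcs = graphs[THEN parcs_subset]

sublocale vertex: cellular_weak_isomorphism
  "pverts G" "graph_algebra G" "pverts G'" "graph_algebra G'" f
  using equivalence fin arcs
  by unfold_locales (auto simp: graph_equivalence_def cellular_graph_algebra)

sublocale pair: cellular_weak_isomorphism
  "tuples (pverts G) 2" "extension (pverts G) (graph_algebra G) 2"
  "tuples (pverts G') 2" "extension (pverts G') (graph_algebra G') 2" F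
  using extension_iso fin arcs
  by unfold_locales (simp_all add: cellular_graph_algebra cellular_extension finite_tuples_2)

lemma corr_adj_matrix: "vertex.corr (adj_matrix G) (adj_matrix G')"
proof -
  have "adj_matrix G \<in> graph_algebra G"
    unfolding graph_algebra_def cellular_closure_def by (simp add: hull_inc)
  thus ?thesis
    using equivalence by (simp add: vertex.corr_def graph_equivalence_def)
qed

lemma extension_contains:
  "tensor_power (graph_algebra G) 2 \<union> sym_invariant (pverts G) 2
    \<subseteq> extension (pverts G) (graph_algebra G) 2"
  unfolding extension_def cellular_closure_def by (rule hull_subset)

lemma corr_tensor:
  assumes "vertex.corr X X'" "vertex.corr Y Y'"
  shows "pair.corr (tensor [X, Y]) (tensor [X', Y'])"
proof -
  have in_W: "set [X, Y] \<subseteq> graph_algebra G" "length [X, Y] = 2"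
    using assms by (auto simp: vertex.corr_def)
  have "tensor [X, Y] \<in> tensor_power (graph_algebra G) 2"
    unfolding tensor_power_def using in_W
    by (intro subsetD[OF hull_subset]) blast
  moreover have "F (tensor [X, Y]) = tensor (map f [X, Y])"
    using on_tensors in_W unfolding restricts_to_tensor_power_def by blast
  ultimately show ?thesis
    using assms extension_contains by (auto simp: pair.corr_def vertex.corr_def)
qed

lemma corr_pattern_matrix:
  "pair.corr (pattern_matrix (pverts G) \<phi>) (pattern_matrix (pverts G') \<phi>)"
proof -
  let ?Z = "pattern_matrix (pverts G) \<phi>"
  have corr: "pair.corr ?Z (F ?Z)"
    using extension_contains pattern_matrix_sym_invariant by (auto simp: pair.corr_def)
  have "F ?Z = pattern_matrix (pverts G') \<phi>"
  proof (rule Mat_tuples_2_eqI)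
    fix a' b' c' d'
    assume V': "a' \<in> pverts G'" "b' \<in> pverts G'" "c' \<in> pverts G'" "d' \<in> pverts G'"
    have preimage: "\<exists>x. x \<in> pverts G \<and> x' = \<sigma> x" if "x' \<in> pverts G'" for x'
      using bij that by (auto simp: bij_betw_def)
    obtain a b c d where V: "a \<in> pverts G" "b \<in> pverts G" "c \<in> pverts G" "d \<in> pverts G"
      and \<sigma>: "a' = \<sigma> a" "b' = \<sigma> b" "c' = \<sigma> c" "d' = \<sigma> d"
      using V'[THEN preimage] by blast
    have "F ?Z (map \<sigma> [a, b]) (map \<sigma> [c, d]) = ?Z [a, b] [c, d]"
      using on_invariants pattern_matrix_sym_invariant V
      unfolding identity_on_sym_invariant_def by (metis in_tuples_2)
    also have "\<dots> = pattern_matrix (pverts G') \<phi> (map \<sigma> [a, b]) (map \<sigma> [c, d])"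
      using V by (intro pattern_matrix_map[OF bij, symmetric]) auto
    finally show "F ?Z [a', b'] [c', d'] = pattern_matrix (pverts G') \<phi> [a', b'] [c', d']"
      by (simp add: \<sigma>)
  qed (use pair.corr_Mat[OF corr] pattern_matrix_Mat in auto)
  thus ?thesis using corr by simp
qed

lemma corr_arc_identity:
  "pair.corr (pair_lists (imat_id (parcs G))) (pair_lists (imat_id (parcs G')))"
  unfolding arc_identity_formula[OF fin(1) arcs(1)] arc_identity_formula[OF fin(2) arcs(2)]
  by (intro pair.corr_mult pair.corr_hadamard corr_tensor corr_pattern_matrix corr_adj_matrix
      vertex.corr_all_ones)

lemma corr_transition_matrix:
  "pair.corr (pair_lists (complexify (transition_matrix G)))
    (pair_lists (complexify (transition_matrix G')))"
  unfolding transition_matrix_formula[OF fin(1) arcs(1)] transition_matrix_formula[OF fin(2) arcs(2)]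
  by (intro pair.corr_mult pair.corr_add pair.corr_hadamard pair.corr_scale corr_tensor
      corr_pattern_matrix corr_arc_identity vertex.corr_entrywise vertex.corr_mult corr_adj_matrix
      vertex.corr_all_ones)

text \<open>
  For \<open>k = 0\<close> the power is the identity on the arcs, which on pairs of vertices is only
  a diagonal matrix; this is why lemma \<open>corr_arc_identity\<close> is needed.
\<close>
lemma corr_power:
  assumes "M \<in> Mat (parcs G)" "M' \<in> Mat (parcs G')" "pair.corr (pair_lists M) (pair_lists M')"
  shows "pair.corr (pair_lists (imat_power (parcs G) M k)) (pair_lists (imat_power (parcs G') M' k))"
proof (induction k)
  case (Suc k)
  thus ?case
    using assms pair.corr_mult[OF assms(3) Suc]
    by (simp add: pair_lists_mult[OF fin(1) _ _ arcs(1)] pair_lists_mult[OF fin(2) _ _ arcs(2)]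
        Mat_power)
qed (simp add: corr_arc_identity)

lemma corr_pos_support_power:
  "pair.corr (pair_lists (pos_support (imat_power (parcs G) (transition_matrix G) k)))
    (pair_lists (pos_support (imat_power (parcs G') (transition_matrix G') k)))"
  unfolding pos_support_entrywise[OF Mat_power[OF transition_matrix_Mat] arcs(1)]
    pos_support_entrywise[OF Mat_power[OF transition_matrix_Mat] arcs(2)] complexify_power
  by (intro pair.corr_entrywise corr_power complexify_Mat transition_matrix_Mat
      corr_transition_matrix)

lemma imat_spec_eq_if_corr:
  assumes "M \<in> Mat (parcs G)" "M' \<in> Mat (parcs G')" "pair.corr (pair_lists M) (pair_lists M')"
  shows "imat_spec (parcs G) M = imat_spec (parcs G') M'"
proof (rule imat_spec_eq_if_traces_eq)
  show "finite (parcs G)" "finite (parcs G')"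
    using fin arcs by (meson finite_SigmaI finite_subset)+
  fix k
  show "imat_trace (parcs G) (imat_power (parcs G) M k) =
      imat_trace (parcs G') (imat_power (parcs G') M' k)"
    \<comment> \<open>traces are only transferred between nonempty index sets\<close>
  proof (cases "pverts G' = {}")
    case True
    hence "parcs G = {}" "parcs G' = {}"
      using arcs bij by (auto simp: bij_betw_def)
    thus ?thesis by (simp add: imat_trace_def)
  next
    case False
    hence "tuples (pverts G') 2 \<noteq> {}" by (simp add: tuples_2)
    thus ?thesis
      using pair.corr_trace[OF corr_power[OF assms, of k]] assms
      by (simp add: pair_lists_trace[OF fin(1) _ arcs(1)] pair_lists_trace[OF fin(2) _ arcs(2)]
          Mat_power)
  qed
qed

end

theorem theorem1:
  fixes G :: "'a pair_pre_digraph" and G' :: "'b pair_pre_digraph"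
  assumes "pair_graph G" and "pair_graph G'"
    and "k_equivalent 2 G G'"
  shows "imat_spec (parcs G) (pos_support (imat_power (parcs G) (transition_matrix G) 3)) =
    imat_spec (parcs G') (pos_support (imat_power (parcs G') (transition_matrix G') 3))"
proof -
  obtain f \<sigma> F where "two_equivalence G G' f \<sigma> F"
    using assms unfolding k_equivalent_def k_equivalence_def two_equivalence_def by blast
  then interpret two_equivalence G G' f \<sigma> F .
  show ?thesis
    by (intro imat_spec_eq_if_corr pos_support_Mat Mat_power transition_matrix_Mat
        corr_pos_support_power)
qed

end
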